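(* Let $n\ge 2$ be even, and let the inter-agent graph be either the undirected ring ($\mathcal N_i=\{i-1,i+1\}$ for all $i\in\mathcal V$) or the directed ring ($\mathcal N_i=\{i+1\}$ for all $i\in\mathcal V$), indices modulo $n$. Consider the closed-loop system on $(\mathcal S^2)^n$ $$\dot\Gamma_i=\Gamma_i\times\Big(\Gamma_i\times\sum_{j\in\mathcal N_i}\Gamma_j\Big),\qquad i=1,\dots,n.$$ Then the invariant set $$\mathcal M_e=\{\mathbf\Gamma\in(\mathcal S^2)^n:\ \exists v\in\mathcal S^2 \text{ with } \Gamma_i=(-1)^{i-1}v\ \ \forall i\in\mathcal V\}$$ is asymptotically stable, with region of attraction containing $$\Omega_e=\{\mathbf\Gamma\in(\mathcal S^2)^n:\ W(\mathbf\Gamma)>\pi-2\pi/n\}.$$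
   Context: $\mathcal S^2=\{x\in\mathbb R^3:\|x\|=1\}$, $\mathcal V=\{1,\dots,n\}$, and indices are taken modulo $n$ (so $n+1$ means $1$ and $0$ means $n$). Points of $(\mathcal S^2)^n$ are written $\mathbf\Gamma=\{\Gamma_i\}_{i\in\mathcal V}$. The geodesic distance is $d_{\mathcal S^2}(\Gamma_i,\Gamma_j)=\theta_{ij}=\arccos(\Gamma_i^T\Gamma_j)\in[0,\pi]$, and $W(\mathbf\Gamma)=\min_{i\in\mathcal V}d_{\mathcal S^2}(\Gamma_i,\Gamma_{i+1})$. The metric on $(\mathcal S^2)^n$ is $d_{(\mathcal S^2)^n}(\mathbf\Gamma,\bar{\mathbf\Gamma})=\max_{i}d_{\mathcal S^2}(\Gamma_i,\bar\Gamma_i)$, and for a set $\mathcal M$, $d_{\mathcal M}(\mathbf\Gamma)=\inf_{\bar{\mathbf\Gamma}\in\mathcal M}d_{(\mathcal S^2)^n}(\mathbf\Gamma,\bar{\mathbf\Gamma})$. $\mathcal N_i$ is the set (not multiset) of neighbors of agent $i$. A positively invariant set $\mathcal M$ is stable if for every $\varepsilon>0$ there is $\delta>0$ such that $d_{\mathcal M}(\mathbf\Gamma(0))<\delta$ implies $d_{\mathcal M}(\mathbf\Gamma(t))<\varepsilon$ for all $t\ge0$. It is asymptotically stable with region of attraction containing $\Omega$ (where $\Omega$ contains a neighborhood of $\mathcal M$) if it is stable and $\lim_{t\to\infty}d_{\mathcal M}(\mathbf\Gamma(t))=0$ for every trajectory with $\mathbf\Gamma(0)\in\Omega$. *)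

theory Defs
  imports "HOL-Analysis.Analysis"
begin

section \<open>Stability of sets\<close>

text \<open>A dynamical system is given by its set \<open>Traj\<close> of trajectories (functions of time, only
  their values on \<open>[0, \<infinity>)\<close> matter) in a metric state space with carrier \<open>X\<close> and metric \<open>d\<close>.\<close>

definition dist_to_set :: "('s \<Rightarrow> 's \<Rightarrow> real) \<Rightarrow> 's set \<Rightarrow> 's \<Rightarrow> real" where
  "dist_to_set d M x = (INF y\<in>M. d x y)"

definition positively_invariant :: "(real \<Rightarrow> 's) set \<Rightarrow> 's set \<Rightarrow> bool" where
  "positively_invariant Traj M \<longleftrightarrow> (\<forall>\<gamma>\<in>Traj. \<gamma> 0 \<in> M \<longrightarrow> (\<forall>t\<ge>0. \<gamma> t \<in> M))"

definition stable_set :: "('s \<Rightarrow> 's \<Rightarrow> real) \<Rightarrow> (real \<Rightarrow> 's) set \<Rightarrow> 's set \<Rightarrow> bool" where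
  "stable_set d Traj M \<longleftrightarrow>
     positively_invariant Traj M \<and>
     (\<forall>\<epsilon>>0. \<exists>\<delta>>0. \<forall>\<gamma>\<in>Traj. dist_to_set d M (\<gamma> 0) < \<delta> \<longrightarrow>
        (\<forall>t\<ge>0. dist_to_set d M (\<gamma> t) < \<epsilon>))"

text \<open>\<open>\<Omega>\<close> is a neighborhood of every point of \<open>M\<close>, i.e. it contains an open set
  (relative to \<open>X\<close>) that contains \<open>M\<close>.\<close>

definition contains_nbhd_of ::
    "'s set \<Rightarrow> ('s \<Rightarrow> 's \<Rightarrow> real) \<Rightarrow> 's set \<Rightarrow> 's set \<Rightarrow> bool" where
  "contains_nbhd_of X d M \<Omega> \<longleftrightarrow> (\<forall>x\<in>M. \<exists>r>0. {y\<in>X. d x y < r} \<subseteq> \<Omega>)"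

definition asymptotically_stable_with_region ::
    "'s set \<Rightarrow> ('s \<Rightarrow> 's \<Rightarrow> real) \<Rightarrow> (real \<Rightarrow> 's) set \<Rightarrow> 's set \<Rightarrow> 's set \<Rightarrow> bool" where
  "asymptotically_stable_with_region X d Traj M \<Omega> \<longleftrightarrow>
     stable_set d Traj M \<and>
     contains_nbhd_of X d M \<Omega> \<and>
     (\<forall>\<gamma>\<in>Traj. \<gamma> 0 \<in> \<Omega> \<longrightarrow> ((\<lambda>t. dist_to_set d M (\<gamma> t)) \<longlongrightarrow> 0) at_top)"

section \<open>Reduced attitudes on a ring graph\<close>

text \<open>Agents are \<open>{1..n}\<close>; \<open>n + 1\<close> is read as \<open>1\<close> and \<open>0\<close> as \<open>n\<close>.\<close>

definition ring_next :: "nat \<Rightarrow> nat \<Rightarrow> nat" where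
  "ring_next n i = (if i = n then 1 else i + 1)"

definition ring_prev :: "nat \<Rightarrow> nat \<Rightarrow> nat" where
  "ring_prev n i = (if i = 1 then n else i - 1)"

definition undirected_ring :: "nat \<Rightarrow> (nat \<Rightarrow> nat set) \<Rightarrow> bool" where
  "undirected_ring n N \<longleftrightarrow> (\<forall>i\<in>{1..n}. N i = {ring_prev n i, ring_next n i})"

definition directed_ring :: "nat \<Rightarrow> (nat \<Rightarrow> nat set) \<Rightarrow> bool" where
  "directed_ring n N \<longleftrightarrow> (\<forall>i\<in>{1..n}. N i = {ring_next n i})"

definition sphere_power :: "nat \<Rightarrow> (nat \<Rightarrow> real^3) set" where
  "sphere_power n = {1..n} \<rightarrow>\<^sub>E sphere 0 1"

definition geodesic_dist :: "real^3 \<Rightarrow> real^3 \<Rightarrow> real" where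
  "geodesic_dist x y = arccos (x \<bullet> y)"

definition max_geodesic_dist :: "nat \<Rightarrow> (nat \<Rightarrow> real^3) \<Rightarrow> (nat \<Rightarrow> real^3) \<Rightarrow> real" where
  "max_geodesic_dist n \<Gamma> \<Gamma>' = Max ((\<lambda>i. geodesic_dist (\<Gamma> i) (\<Gamma>' i)) ` {1..n})"

definition min_ring_dist :: "nat \<Rightarrow> (nat \<Rightarrow> real^3) \<Rightarrow> real" where
  "min_ring_dist n \<Gamma> = Min ((\<lambda>i. geodesic_dist (\<Gamma> i) (\<Gamma> (ring_next n i))) ` {1..n})"

text \<open>At time \<open>0\<close> the derivative is the one-sided one.\<close>

definition closed_loop_trajectories ::
    "nat \<Rightarrow> (nat \<Rightarrow> nat set) \<Rightarrow> (real \<Rightarrow> nat \<Rightarrow> real^3) set" where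
  "closed_loop_trajectories n N =
     {\<gamma>. (\<forall>t\<ge>0. \<gamma> t \<in> sphere_power n) \<and>
          (\<forall>t\<ge>0. \<forall>i\<in>{1..n}.
             ((\<lambda>s. \<gamma> s i) has_vector_derivative
                cross3 (\<gamma> t i) (cross3 (\<gamma> t i) (\<Sum>j\<in>N i. \<gamma> t j))) (at t within {0..}))}"

definition antipodal_set :: "nat \<Rightarrow> (nat \<Rightarrow> real^3) set" where
  "antipodal_set n =
     {\<Gamma> \<in> sphere_power n. \<exists>v \<in> sphere 0 1. \<forall>i\<in>{1..n}. \<Gamma> i = (- 1) ^ (i - 1) *\<^sub>R v}"

definition attraction_set :: "nat \<Rightarrow> (nat \<Rightarrow> real^3) set" where
  "attraction_set n = {\<Gamma> \<in> sphere_power n. min_ring_dist n \<Gamma> > pi - 2 * pi / real n}"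

end

theory Submission
  imports Defs
begin

text \<open>
  Put \<open>x\<^sub>i = (-1)\<^bsup>i-1\<^esup> \<Gamma>\<^sub>i\<close>. Since \<open>n\<close> is even, neighbours on the ring carry opposite signs, and the
  repulsive closed loop becomes the attractive consensus flow
  \<open>x\<^sub>i' = \<Sum>\<^sub>j (x\<^sub>j - (x\<^sub>i \<bullet> x\<^sub>j) x\<^sub>i)\<close> (\<open>alternate_consensus\<close>). The antipodal set becomes the set where
  all \<open>x\<^sub>i\<close> coincide, and \<open>W(\<Gamma>) > \<pi> - 2\<pi>/n\<close> says that consecutive points \<open>x\<^sub>i\<close>, \<open>x\<^sub>i\<^sub>+\<^sub>1\<close> are less
  than \<open>2\<pi>/n\<close> apart, so that they are the corners of a closed polygon of length below \<open>2\<pi>\<close>.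

  The key to the dynamics is that for a fixed vector \<open>f\<close> the numbers \<open>x\<^sub>i \<bullet> f\<close> satisfy
  \<open>(x\<^sub>i \<bullet> f)' = \<Sum>\<^sub>j x\<^sub>j \<bullet> f - c\<^sub>i (x\<^sub>i \<bullet> f)\<close> with a bounded coefficient \<open>c\<^sub>i\<close>: a cooperative linear
  system. Hence signs are preserved. A closed half space through the origin that contains all the
  points keeps them (\<open>half_space_invariant\<close>), and so does a cap \<open>x \<bullet> v \<ge> m\<close> with \<open>m \<ge> 0\<close>
  (\<open>cap_invariant\<close>); the caps around a consensus point give invariance and stability.

  For the attraction, a closed polygon of length below \<open>2\<pi>\<close> lies in an open hemisphere: choose two
  corners that halve the number of edges, then the sum of these two corners has positive inner
  product with every corner (\<open>short_closed_polygon_in_hemisphere\<close>). Since there are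
  finitely many agents, cap invariance keeps the flow in a cap \<open>x \<bullet> v \<ge> m > 0\<close>. There the central projection
  \<open>x / (x \<bullet> v)\<close> makes sense, and half space invariance says that for every \<open>e\<close> the range \<open>[lo, hi]\<close> of the
  quotients \<open>(x\<^sub>i \<bullet> e) / (x\<^sub>i \<bullet> v)\<close> can only shrink. It shrinks by a fixed factor in a fixed time: the
  quotient of a root agent lies below or above the midpoint of the range, say below, and then the
  nonnegative functional given by \<open>f = hi v - e\<close> is bounded below at the root. This positivity
  propagates from each agent to those that see it, hence to all agents (\<open>uniform_gain_from_root\<close>), which pushes the
  upper end of the range down. So all quotients converge to each other, for each \<open>e\<close>, and the points
  converge to consensus (\<open>consensus_from_open_hemisphere\<close>). All that the argument
  uses of the graph is a path from every agent to the root, so it covers the directed and the undirected ring at once.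
\<close>

section \<open>Cooperative differential inequalities\<close>

text \<open>Adding \<open>\<eta> exp (L t)\<close> with a large rate \<open>L\<close> makes the initial values positive and the inequality
  strict. At the first time when some perturbed component vanishes, the other ones are still
  nonnegative, so the inequality makes its derivative positive; but a component that comes down to
  \<open>0\<close> from positive values cannot have a positive derivative there. So the perturbed components stay
  positive, and \<open>\<eta>\<close> tends to \<open>0\<close>.\<close>

lemma cooperative_nonneg:
  fixes b b' c :: "real \<Rightarrow> 'i \<Rightarrow> real"
  assumes fin: "finite I" and sub: "\<And>i. i \<in> I \<Longrightarrow> N i \<subseteq> I" and s: "s \<ge> 0"
    and deriv: "\<And>t i. t \<ge> 0 \<Longrightarrow> i \<in> I \<Longrightarrow> ((\<lambda>s. b s i) has_real_derivative b' t i) (at t within {0..})"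
    and ineq: "\<And>t i. t \<ge> 0 \<Longrightarrow> i \<in> I \<Longrightarrow> b' t i \<ge> (\<Sum>j\<in>N i. b t j) - c t i * b t i"
    and bound: "\<And>t i. t \<ge> 0 \<Longrightarrow> i \<in> I \<Longrightarrow> \<bar>c t i\<bar> \<le> C"
    and init: "\<And>i. i \<in> I \<Longrightarrow> b s i \<ge> 0"
    and t: "t \<ge> s" and i: "i \<in> I"
  shows "b t i \<ge> 0"
proof -
  \<comment> \<open>The rate dominates the number of neighbours and the coefficient \<open>c\<close>, with a margin for strictness.\<close>
  define L where "L = card I + C + 1"
  have "b t i + \<eta> * exp (L * t) > 0" if \<eta>: "\<eta> > 0" for \<eta> :: real
  proof (rule ccontr)
    assume neg: "\<not> ?thesis"
    define p where "p = (\<lambda>u j. b u j + \<eta> * exp (L * u))"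
    have pd: "((\<lambda>u. p u j) has_real_derivative b' u j + \<eta> * (L * exp (L * u))) (at u within {0..})"
      if "u \<ge> 0" "j \<in> I" for u j
      unfolding p_def by (rule derivative_eq_intros deriv that refl | simp)+
    have cont: "continuous_on {s..t} (\<lambda>u. p u j)" if "j \<in> I" for j
    proof -
      have "continuous_on {0..} (\<lambda>u. p u j)"
        using pd[OF _ that] by (intro DERIV_continuous_on) auto
      then show ?thesis by (rule continuous_on_subset) (use s in auto)
    qed
    define A where "A = (\<Union>j\<in>I. {u \<in> {s..t}. p u j \<le> 0})"
    have "closed {u \<in> {s..t}. p u j \<le> 0}" if "j \<in> I" for j
      by (rule continuous_on_closed_Collect_le[OF cont[OF that]]) auto
    then have "closed A" unfolding A_def using fin by auto
    moreover have "A \<subseteq> {s..t}" unfolding A_def by auto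
    ultimately have "compact A"
      by (metis bounded_closed_interval bounded_subset compact_eq_bounded_closed)
    moreover have "t \<in> A" unfolding A_def using neg i t by (auto simp: p_def not_less)
    ultimately obtain u where u: "u \<in> A" "\<And>w. w \<in> A \<Longrightarrow> u \<le> w"
      using compact_attains_inf[of A] by (metis empty_iff)
    \<comment> \<open>\<open>u\<close> is the first time at which a component of the perturbed function fails to be positive.\<close>
    obtain j where j: "j \<in> I" "p u j \<le> 0" and ust: "s \<le> u" "u \<le> t"
      using u(1) unfolding A_def by auto
    have before: "p w k > 0" if "s \<le> w" "w < u" "k \<in> I" for w k
      using u(2)[of w] that ust unfolding A_def by force
    have "p s j > 0"
      using init[OF j(1)] \<eta> by (simp add: p_def add_nonneg_pos)
    then have su: "s < u" using j ust by (cases "s = u") auto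
    have nonneg: "p u k \<ge> 0" if k: "k \<in> I" for k
    proof (rule tendsto_lowerbound)
      have "((\<lambda>w. p w k) \<longlongrightarrow> p u k) (at u within {s..u})"
        using cont[OF k] ust unfolding continuous_on_def
        by (meson atLeastAtMost_iff atLeastatMost_subset_iff order_refl tendsto_within_subset)
      then show "((\<lambda>w. p w k) \<longlongrightarrow> p u k) (at_left u)"
        by (simp add: at_within_Icc_at_left su)
      show "\<forall>\<^sub>F w in at_left u. 0 \<le> p w k"
        using before[OF _ _ k] su by (auto simp: eventually_at_left intro!: exI[of _ s] less_imp_le)
    qed auto
    have zero: "p u j = 0" using nonneg[OF j(1)] j(2) by simp
    have u0: "u \<ge> 0" using s su by simp
    let ?E = "\<eta> * exp (L * u)"
    have E: "?E > 0" using \<eta> by simp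
    have "- ?E \<le> b u k" if "k \<in> N j" for k
      using nonneg[of k] subsetD[OF sub[OF j(1)] that] by (simp add: p_def)
    then have "(\<Sum>k\<in>N j. b u k) \<ge> (\<Sum>k\<in>N j. - ?E)" by (rule sum_mono)
    moreover have "card (N j) * ?E \<le> card I * ?E"
      using card_mono[OF fin sub[OF j(1)]] E by (intro mult_right_mono) auto
    moreover have "c u j * ?E \<ge> - C * ?E"
      using bound[OF u0 j(1)] E by (intro mult_right_mono) auto
    moreover have "b u j = - ?E" using zero by (simp add: p_def)
    ultimately have "b' u j + L * ?E > 0"
      using ineq[OF u0 j(1)] E unfolding L_def by (simp add: algebra_simps)
    then have "b' u j + \<eta> * (L * exp (L * u)) > 0" by (simp add: algebra_simps)
    from has_real_derivative_pos_inc_left[OF pd[OF u0 j(1)] this]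
    obtain d where d: "d > 0" "\<And>h. h > 0 \<Longrightarrow> u - h \<in> {0..} \<Longrightarrow> h < d \<Longrightarrow> p (u - h) j < p u j"
      by blast
    define h where "h = min (d / 2) (u - s)"
    have "h > 0" "h < d" "u - h \<ge> s" using d(1) su by (auto simp: h_def)
    then show False using d(2)[of h] before[of "u - h" j] j(1) s zero by auto
  qed
  then have "- b t i \<le> e" if "e > 0" for e
    using that[THEN divide_pos_pos, OF exp_gt_zero[of "L * t"]] by fastforce
  then show ?thesis using field_le_epsilon[of "- b t i" 0] by simp
qed

section \<open>Consensus flows on the sphere\<close>

text \<open>The radial projection to the unit ball does not increase distances.\<close>

lemma norm_diff_le_norm_scaled_diff:
  fixes x y :: "'a::real_inner"
  assumes "norm x = 1" "norm y = 1" "\<alpha> \<ge> 1" "\<beta> \<ge> 1"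
  shows "norm (x - y) \<le> norm (\<alpha> *\<^sub>R x - \<beta> *\<^sub>R y)"
proof -
  have xy: "x \<bullet> x = 1" "y \<bullet> y = 1" using assms by (simp_all add: dot_square_norm)
  have "x \<bullet> y \<le> 1" using norm_cauchy_schwarz[of x y] assms by simp
  moreover have "\<alpha> * \<beta> \<ge> 1" using assms mult_mono[of 1 \<alpha> 1 \<beta>] by simp
  ultimately have "0 \<le> (\<alpha> - \<beta>)\<^sup>2 + 2 * ((\<alpha> * \<beta> - 1) * (1 - x \<bullet> y))" by simp
  also have "\<dots> = (norm (\<alpha> *\<^sub>R x - \<beta> *\<^sub>R y))\<^sup>2 - (norm (x - y))\<^sup>2"
    unfolding power2_norm_eq_inner using xy
    by (simp add: inner_diff_left inner_diff_right inner_commute[of y x] algebra_simps power2_eq_square)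
  finally have "(norm (x - y))\<^sup>2 \<le> (norm (\<alpha> *\<^sub>R x - \<beta> *\<^sub>R y))\<^sup>2" by linarith
  then show ?thesis by (rule power2_le_imp_le) (rule norm_ge_zero)
qed

lemma nondecreasing_within_half_line:
  fixes g g' :: "real \<Rightarrow> real"
  assumes s: "0 \<le> s" and st: "s \<le> t"
    and deriv: "\<And>w. w \<ge> 0 \<Longrightarrow> (g has_real_derivative g' w) (at w within {0..})"
    and nonneg: "\<And>w. s \<le> w \<Longrightarrow> w \<le> t \<Longrightarrow> g' w \<ge> 0"
  shows "g s \<le> g t"
proof (rule DERIV_nonneg_imp_increasing_open[OF st])
  fix w assume w: "s < w" "w < t"
  have "at w within {0..} = at w" using w s by (intro at_within_interior) auto
  then show "\<exists>y. DERIV g w :> y \<and> 0 \<le> y" using deriv[of w] nonneg[of w] w s by auto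
next
  have "continuous_on {0..} g" using deriv by (intro DERIV_continuous_on) auto
  then show "continuous_on {s..t} g" by (rule continuous_on_subset) (use s in auto)
qed

text \<open>The flow of points on the unit sphere in which each agent moves along the tangential part of the
  sum of its neighbours. The agent \<open>r\<close> influences all agents: an edge from \<open>i\<close> to \<open>j\<close> means that \<open>i\<close> sees \<open>j\<close>.\<close>

locale sphere_consensus =
  fixes I :: "'i set" and N :: "'i \<Rightarrow> 'i set" and r :: 'i
    and x :: "real \<Rightarrow> 'i \<Rightarrow> 'a::euclidean_space"
  assumes finite_agents: "finite I"
    and neighbours: "i \<in> I \<Longrightarrow> N i \<subseteq> I"
    and root: "r \<in> I"
    and rooted: "i \<in> I \<Longrightarrow> (i, r) \<in> {(i, j). i \<in> I \<and> j \<in> N i}\<^sup>*"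
    and unit: "t \<ge> 0 \<Longrightarrow> i \<in> I \<Longrightarrow> norm (x t i) = 1"
    and flow: "t \<ge> 0 \<Longrightarrow> i \<in> I \<Longrightarrow> ((\<lambda>s. x s i) has_vector_derivative
                 (\<Sum>j\<in>N i. x t j - (x t i \<bullet> x t j) *\<^sub>R x t i)) (at t within {0..})"
begin

definition coupling :: "real \<Rightarrow> 'i \<Rightarrow> real" where
  "coupling t i = (\<Sum>j\<in>N i. x t i \<bullet> x t j)"

lemma neighbour_agent: "j \<in> I" if "i \<in> I" "j \<in> N i"
  using neighbours that by blast

lemma inner_le_1: "\<bar>x t i \<bullet> x t j\<bar> \<le> 1" if "t \<ge> 0" "i \<in> I" "j \<in> I"
  using Cauchy_Schwarz_ineq2[of "x t i" "x t j"] unit that by simp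

lemma coupling_bound: "\<bar>coupling t i\<bar> \<le> card I" if "t \<ge> 0" "i \<in> I"
proof -
  have "\<bar>coupling t i\<bar> \<le> (\<Sum>j\<in>N i. 1)"
    unfolding coupling_def
    by (intro order_trans[OF sum_abs] sum_mono inner_le_1 that neighbour_agent[OF that(2)])
  also have "\<dots> \<le> card I" using card_mono[OF finite_agents neighbours[OF that(2)]] by simp
  finally show ?thesis .
qed

text \<open>The nonlinearity of the flow enters only through the bounded scalar coefficient \<open>coupling t i\<close>,
  which is independent of \<open>f\<close>.\<close>

lemma functional_derivative:
  assumes "t \<ge> 0" "i \<in> I"
  shows "((\<lambda>s. x s i \<bullet> f) has_real_derivative
           (\<Sum>j\<in>N i. x t j \<bullet> f) - coupling t i * (x t i \<bullet> f)) (at t within {0..})"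
proof -
  have "((\<lambda>s. x s i \<bullet> f) has_real_derivative
      (\<Sum>j\<in>N i. x t j - (x t i \<bullet> x t j) *\<^sub>R x t i) \<bullet> f) (at t within {0..})"
    using bounded_linear.has_vector_derivative[OF bounded_linear_inner_left flow[OF assms]]
    by (simp add: has_real_derivative_iff_has_vector_derivative)
  then show ?thesis
    by (simp add: inner_sum_left inner_diff_left sum_subtractf coupling_def sum_distrib_right)
qed

lemma half_space_invariant:
  assumes "0 \<le> s" "s \<le> t" "i \<in> I" "\<And>j. j \<in> I \<Longrightarrow> x s j \<bullet> f \<ge> 0"
  shows "x t i \<bullet> f \<ge> 0"
  by (rule cooperative_nonneg[where b = "\<lambda>t i. x t i \<bullet> f" and c = coupling,
        OF finite_agents neighbours assms(1) functional_derivative _ coupling_bound])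
     (use assms in auto)

text \<open>The numbers \<open>x t i \<bullet> v - m\<close> satisfy the cooperative inequality rather than an equation: the
  constant \<open>m\<close> leaves the term \<open>m * (1 - x t i \<bullet> x t j)\<close> for each neighbour \<open>j\<close>, which is nonnegative
  for \<open>m \<ge> 0\<close>.\<close>

lemma cap_invariant:
  assumes "m \<ge> 0" "t \<ge> 0" "i \<in> I" "\<And>j. j \<in> I \<Longrightarrow> x 0 j \<bullet> v \<ge> m"
  shows "x t i \<bullet> v \<ge> m"
proof -
  have "x t i \<bullet> v - m \<ge> 0"
  proof (rule cooperative_nonneg[where b = "\<lambda>t i. x t i \<bullet> v - m" and c = coupling and s = 0
        and b' = "\<lambda>t i. (\<Sum>j\<in>N i. x t j \<bullet> v) - coupling t i * (x t i \<bullet> v)",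
        OF finite_agents neighbours _ _ _ coupling_bound])
    fix t i assume *: "(0::real) \<le> t" "i \<in> I"
    show "((\<lambda>s. x s i \<bullet> v - m) has_real_derivative
        (\<Sum>j\<in>N i. x t j \<bullet> v) - coupling t i * (x t i \<bullet> v)) (at t within {0..})"
      using DERIV_diff[OF functional_derivative[OF *] DERIV_const] by simp
    have "(\<Sum>j\<in>N i. m * (x t i \<bullet> x t j)) \<le> (\<Sum>j\<in>N i. m * 1)"
      by (intro sum_mono mult_left_mono abs_le_D1[OF inner_le_1] assms(1) * neighbour_agent[OF *(2)])
    then show "(\<Sum>j\<in>N i. x t j \<bullet> v - m) - coupling t i * (x t i \<bullet> v - m)
        \<le> (\<Sum>j\<in>N i. x t j \<bullet> v) - coupling t i * (x t i \<bullet> v)"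
      by (simp add: sum_subtractf coupling_def sum_distrib_right[symmetric]
          sum_distrib_left[symmetric] algebra_simps)
  qed (use assms in auto)
  then show ?thesis by simp
qed

text \<open>The exponential factor compensates the largest possible decay rate, so that positive functionals
  become nondecreasing in time.\<close>

definition inflated :: "'a \<Rightarrow> real \<Rightarrow> 'i \<Rightarrow> real" where
  "inflated f t i = exp (real (card I) * t) * (x t i \<bullet> f)"

lemma inflated_derivative:
  assumes "t \<ge> 0" "i \<in> I"
  shows "((\<lambda>t. inflated f t i) has_real_derivative
           (\<Sum>j\<in>N i. inflated f t j) + (card I - coupling t i) * inflated f t i) (at t within {0..})"
  unfolding inflated_def
  by (rule derivative_eq_intros functional_derivative assms refl | simp)+
     (simp add: algebra_simps sum_distrib_left)

lemma inflated_nonneg: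
  assumes "0 \<le> s" "s \<le> t" "i \<in> I" "\<And>j. j \<in> I \<Longrightarrow> x s j \<bullet> f \<ge> 0"
  shows "inflated f t i \<ge> 0"
  using half_space_invariant[OF assms] by (simp add: inflated_def)

lemma inflated_derivative_lower:
  assumes "0 \<le> s" "s \<le> t" "i \<in> I" "\<And>j. j \<in> I \<Longrightarrow> x s j \<bullet> f \<ge> 0"
  shows "(\<Sum>j\<in>N i. inflated f t j) \<le>
           (\<Sum>j\<in>N i. inflated f t j) + (card I - coupling t i) * inflated f t i"
  using inflated_nonneg[OF assms] coupling_bound[of t i] assms(1-3)
  by (auto intro!: mult_nonneg_nonneg)

lemma inflated_mono:
  assumes "0 \<le> s" "s \<le> t" "i \<in> I" "\<And>j. j \<in> I \<Longrightarrow> x s j \<bullet> f \<ge> 0"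
  shows "inflated f s i \<le> inflated f t i"
proof (rule nondecreasing_within_half_line[OF assms(1,2) inflated_derivative[OF _ assms(3)]])
  fix w assume w: "s \<le> w" "w \<le> t"
  have "0 \<le> (\<Sum>j\<in>N i. inflated f w j)"
    by (intro sum_nonneg inflated_nonneg[OF assms(1) w(1) neighbour_agent[OF assms(3)] assms(4)])
  then show "0 \<le> (\<Sum>j\<in>N i. inflated f w j) + (card I - coupling w i) * inflated f w i"
    using inflated_derivative_lower[OF assms(1) w(1) assms(3,4)] by linarith
qed

text \<open>An agent \<open>i\<close> that sees \<open>j\<close> gains at least the current value of \<open>j\<close> per unit of time, because the value
  of \<open>j\<close> does not decrease afterwards.\<close>

lemma inflated_passes_to_listener:
  assumes s: "0 \<le> s" and i: "i \<in> I" and j: "j \<in> N i"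
    and nonneg: "\<And>k. k \<in> I \<Longrightarrow> x s k \<bullet> f \<ge> 0"
  shows "inflated f s j \<le> inflated f (s + 1) i"
proof -
  let ?B = "inflated f s j"
  have jI: "j \<in> I" by (rule neighbour_agent[OF i j])
  have "inflated f s i - s * ?B \<le> inflated f (s + 1) i - (s + 1) * ?B"
  proof (rule nondecreasing_within_half_line[where g = "\<lambda>w. inflated f w i - w * ?B"])
    fix w :: real assume "w \<ge> 0"
    then show "((\<lambda>w. inflated f w i - w * ?B) has_real_derivative
        (\<Sum>j\<in>N i. inflated f w j) + (card I - coupling w i) * inflated f w i - ?B) (at w within {0..})"
      by (auto intro!: derivative_eq_intros inflated_derivative i)
  next
    fix w assume w: "s \<le> w" "w \<le> s + 1"
    have "?B \<le> inflated f w j" by (rule inflated_mono[OF s w(1) jI nonneg])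
    also have "\<dots> \<le> (\<Sum>j\<in>N i. inflated f w j)"
      using inflated_nonneg[OF s w(1) neighbour_agent[OF i] nonneg]
        finite_subset[OF neighbours[OF i] finite_agents]
      by (intro member_le_sum j) auto
    also note inflated_derivative_lower[OF s w(1) i nonneg]
    finally show "0 \<le> (\<Sum>j\<in>N i. inflated f w j) + (card I - coupling w i) * inflated f w i - ?B"
      by simp
  qed (use s in auto)
  moreover have "?B \<ge> 0" using inflated_nonneg[OF s order_refl jI nonneg] .
  ultimately show ?thesis using inflated_nonneg[OF s order_refl i nonneg]
    by (simp add: algebra_simps)
qed

text \<open>Each edge on a path to the root costs one unit of time.\<close>

lemma root_reaches_agent:
  assumes "i \<in> I"
  shows "\<exists>k::nat. \<forall>f s. 0 \<le> s \<longrightarrow> (\<forall>j\<in>I. x s j \<bullet> f \<ge> 0) \<longrightarrow> inflated f s r \<le> inflated f (s + k) i"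
  using rooted[OF assms]
proof (induction rule: converse_rtrancl_induct)
  case base
  show ?case by (rule exI[of _ 0]) simp
next
  case (step i j)
  then have ij: "i \<in> I" "j \<in> N i" by auto
  from step.IH obtain k :: nat where
    k: "\<And>f s. 0 \<le> s \<Longrightarrow> (\<forall>j\<in>I. x s j \<bullet> f \<ge> 0) \<Longrightarrow> inflated f s r \<le> inflated f (s + k) j"
    by blast
  have "inflated f s r \<le> inflated f (s + Suc k) i" if "0 \<le> s" "\<forall>j\<in>I. x s j \<bullet> f \<ge> 0" for f s
  proof -
    have "inflated f s r \<le> inflated f (s + k) j" using k that by blast
    also have "\<dots> \<le> inflated f (s + k + 1) i"
      using that half_space_invariant[of s "s + k"] by (intro inflated_passes_to_listener ij) auto
    finally show ?thesis by (simp add: algebra_simps)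
  qed
  then show ?case by blast
qed

text \<open>A time \<open>T\<close> that serves all agents exists because there are finitely many; the factor \<open>\<kappa>\<close> is the
  exponential compensation over that time. Neither depends on the functional or on the initial time.\<close>

lemma uniform_gain_from_root:
  "\<exists>(\<kappa>::real) (T::nat). 0 < \<kappa> \<and> \<kappa> \<le> 1 \<and>
     (\<forall>f s. 0 \<le> s \<longrightarrow> (\<forall>j\<in>I. x s j \<bullet> f \<ge> 0) \<longrightarrow> (\<forall>i\<in>I. \<kappa> * (x s r \<bullet> f) \<le> x (s + T) i \<bullet> f))"
proof -
  let ?reach = "\<lambda>i (k::nat). \<forall>f s. 0 \<le> s \<longrightarrow> (\<forall>j\<in>I. x s j \<bullet> f \<ge> 0) \<longrightarrow> inflated f s r \<le> inflated f (s + k) i"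
  have "\<forall>i\<in>I. \<exists>k. ?reach i k" using root_reaches_agent by (rule ballI)
  then obtain k where k: "\<forall>i\<in>I. ?reach i (k i)" by (rule bchoice[THEN exE])
  define T where "T = Max (k ` I)"
  let ?\<kappa> = "exp (- (real (card I) * real T))"
  have "?\<kappa> * (x s r \<bullet> f) \<le> x (s + T) i \<bullet> f"
    if s: "0 \<le> s" and nonneg: "\<forall>j\<in>I. x s j \<bullet> f \<ge> 0" and i: "i \<in> I" for f s i
  proof -
    have "k i \<le> T" unfolding T_def using finite_agents i by simp
    have "inflated f s r \<le> inflated f (s + k i) i" using k s i nonneg by blast
    also have "\<dots> \<le> inflated f (s + T) i"
      using half_space_invariant[of s "s + k i"] s nonneg \<open>k i \<le> T\<close> by (intro inflated_mono i) auto
    finally have "exp (real (card I) * s) * (x s r \<bullet> f) \<le> exp (real (card I) * s) * (exp (real (card I) * real T) * (x (s + T) i \<bullet> f))"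
      by (simp add: inflated_def distrib_left exp_add mult_ac)
    then show ?thesis by (simp add: exp_minus field_simps)
  qed
  moreover have "0 < ?\<kappa>" "?\<kappa> \<le> 1" by simp_all
  ultimately show ?thesis by blast
qed

text \<open>When \<open>v\<close> has positive inner product with all points, the next predicate bounds the quotients
  \<open>(x t i \<bullet> e) / (x t i \<bullet> v)\<close>, a coordinate of the central projection. Without the division it is a
  conjunction of two half space conditions.\<close>

definition quotients_within :: "'a \<Rightarrow> 'a \<Rightarrow> real \<Rightarrow> real \<Rightarrow> real \<Rightarrow> bool" where
  "quotients_within e v lo hi t \<longleftrightarrow> (\<forall>i\<in>I. x t i \<bullet> e \<in> {lo * (x t i \<bullet> v)..hi * (x t i \<bullet> v)})"

lemma quotients_within_half_spaces:
  "quotients_within e v lo hi t \<longleftrightarrow>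
     (\<forall>i\<in>I. x t i \<bullet> (e - lo *\<^sub>R v) \<ge> 0) \<and> (\<forall>i\<in>I. x t i \<bullet> (hi *\<^sub>R v - e) \<ge> 0)"
  unfolding quotients_within_def by (auto simp: inner_diff_right)

lemma quotients_within_invariant:
  assumes "0 \<le> s" "s \<le> t" "quotients_within e v lo hi s"
  shows "quotients_within e v lo hi t"
  using assms half_space_invariant[OF assms(1,2)] unfolding quotients_within_half_spaces by blast

lemma quotients_within_uminus:
  "quotients_within (- e) v (- hi) (- lo) t \<longleftrightarrow> quotients_within e v lo hi t"
  unfolding quotients_within_def by auto

text \<open>Replacing \<open>e\<close> by \<open>- e\<close> if necessary, the quotient of the root lies in the lower half of the
  range. Then \<open>hi *\<^sub>R v - e\<close> is nonnegative on all points and at least \<open>m * (hi - lo) / 2\<close> at the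
  root, and the gain from the root turns this into a lower bound at every agent, which lowers the
  upper end of the range by a fixed proportion.\<close>

lemma quotient_range_contracts:
  assumes m: "m > 0" and v: "norm v = 1" and cap_all: "\<forall>t\<ge>0. \<forall>i\<in>I. x t i \<bullet> v \<ge> m"
  shows "\<exists>(\<rho>::real) (T::nat). 0 < \<rho> \<and> \<rho> < 1 \<and>
    (\<forall>s e lo hi. 0 \<le> s \<longrightarrow> lo \<le> hi \<longrightarrow> quotients_within e v lo hi s \<longrightarrow>
      (\<exists>lo' hi'. lo' \<le> hi' \<and> hi' - lo' = \<rho> * (hi - lo) \<and> quotients_within e v lo' hi' (s + T)))"
proof -
  obtain \<kappa> :: real and T :: nat where \<kappa>: "0 < \<kappa>" "\<kappa> \<le> 1"
    and gain: "\<forall>f s. 0 \<le> s \<longrightarrow> (\<forall>j\<in>I. x s j \<bullet> f \<ge> 0) \<longrightarrow> (\<forall>i\<in>I. \<kappa> * (x s r \<bullet> f) \<le> x (s + T) i \<bullet> f)"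
    using uniform_gain_from_root by (elim exE conjE) (rule that)
  have cap: "x t i \<bullet> v \<ge> m" if "t \<ge> 0" "i \<in> I" for t i using cap_all that by blast
  have a1: "x t i \<bullet> v \<le> 1" if "t \<ge> 0" "i \<in> I" for t i
    using norm_cauchy_schwarz[of "x t i" v] unit that v by simp
  have m1: "m \<le> 1" using cap[of 0 r] a1[of 0 r] root by simp
  define g where "g = \<kappa> * m / 2"
  have "\<kappa> * m \<le> 1 * 1" using \<kappa> m m1 by (intro mult_mono) auto
  then have g: "g > 0" "g < 1" unfolding g_def using \<kappa> m by auto
  have upper: "quotients_within e v lo (hi - g * (hi - lo)) (s + T)"
    if s: "0 \<le> s" and lohi: "lo \<le> hi" and within: "quotients_within e v lo hi s"
      and mid: "x s r \<bullet> e \<le> (lo + hi) / 2 * (x s r \<bullet> v)" for s e lo hi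
    unfolding quotients_within_def
  proof
    fix i assume i: "i \<in> I"
    let ?f = "hi *\<^sub>R v - e" and ?a = "x (s + T) i \<bullet> v"
    have "(hi - lo) / 2 * m \<le> (hi - lo) / 2 * (x s r \<bullet> v)"
      using cap[OF s root] lohi by (intro mult_left_mono) auto
    also have "\<dots> \<le> x s r \<bullet> ?f" using mid by (simp add: inner_diff_right field_simps)
    finally have "\<kappa> * ((hi - lo) / 2 * m) \<le> \<kappa> * (x s r \<bullet> ?f)" using \<kappa> by simp
    also have "\<dots> \<le> x (s + T) i \<bullet> ?f"
      using gain s i within unfolding quotients_within_half_spaces by blast
    finally have "g * (hi - lo) \<le> hi * ?a - x (s + T) i \<bullet> e" by (simp add: g_def inner_diff_right mult_ac)
    \<comment> \<open>Since \<open>?a \<le> 1\<close>, the gain remains valid as a multiple of \<open>?a\<close>, which is the form of the predicate.\<close>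
    moreover have "g * (hi - lo) * ?a \<le> g * (hi - lo) * 1"
      using a1[of "s + T" i] s i g lohi by (intro mult_left_mono) auto
    ultimately have "x (s + T) i \<bullet> e \<le> (hi - g * (hi - lo)) * ?a" by (simp add: algebra_simps)
    moreover have "lo * ?a \<le> x (s + T) i \<bullet> e"
      using quotients_within_invariant[OF s _ within, of "s + T"] i unfolding quotients_within_def by simp
    ultimately show "x (s + T) i \<bullet> e \<in> {lo * ?a..(hi - g * (hi - lo)) * ?a}" by simp
  qed
  have "\<exists>lo' hi'. lo' \<le> hi' \<and> hi' - lo' = (1 - g) * (hi - lo) \<and> quotients_within e v lo' hi' (s + T)"
    if s: "0 \<le> s" and lohi: "lo \<le> hi" and within: "quotients_within e v lo hi s" for s e lo hi
  proof -
    have gw: "g * (hi - lo) \<le> 1 * (hi - lo)" using g lohi by (intro mult_right_mono) auto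
    consider "x s r \<bullet> e \<le> (lo + hi) / 2 * (x s r \<bullet> v)" | "x s r \<bullet> - e \<le> (- hi + - lo) / 2 * (x s r \<bullet> v)"
      by (fastforce simp: field_simps)
    then show ?thesis
    proof cases
      case 1
      show ?thesis
        using upper[OF s lohi within 1] gw
        by (intro exI[of _ lo] exI[of _ "hi - g * (hi - lo)"]) (auto simp: algebra_simps)
    next
      case 2
      have "quotients_within (- e) v (- hi) (- lo - g * (- lo - - hi)) (s + T)"
        using lohi within by (intro upper[OF s _ _ 2]) (auto simp: quotients_within_uminus)
      moreover have "- lo - g * (- lo - - hi) = - (lo + g * (hi - lo))" by (simp add: algebra_simps)
      ultimately have "quotients_within e v (lo + g * (hi - lo)) hi (s + T)"
        by (simp only: quotients_within_uminus)
      then show ?thesis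
        using gw by (intro exI[of _ "lo + g * (hi - lo)"] exI[of _ hi]) (auto simp: algebra_simps)
    qed
  qed
  then show ?thesis using g by (intro exI[of _ "1 - g"] exI[of _ T]) auto
qed

text \<open>The ranges at the multiples of \<open>T\<close> shrink geometrically from the initial range
  \<open>[- norm e / m, norm e / m]\<close>, and each range also bounds all later quotients.\<close>

lemma quotients_converge:
  assumes m: "m > 0" and v: "norm v = 1" and cap_all: "\<forall>t\<ge>0. \<forall>i\<in>I. x t i \<bullet> v \<ge> m"
    and i: "i \<in> I"
  shows "((\<lambda>t. (x t i \<bullet> e) / (x t i \<bullet> v) - (x t r \<bullet> e) / (x t r \<bullet> v)) \<longlongrightarrow> 0) at_top"
proof -
  obtain \<rho> :: real and T :: nat where \<rho>: "0 < \<rho>" "\<rho> < 1" and contract: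
    "\<forall>s e lo hi. 0 \<le> s \<longrightarrow> lo \<le> hi \<longrightarrow> quotients_within e v lo hi s \<longrightarrow>
      (\<exists>lo' hi'. lo' \<le> hi' \<and> hi' - lo' = \<rho> * (hi - lo) \<and> quotients_within e v lo' hi' (s + T))"
    using quotient_range_contracts[OF m v cap_all] by (elim exE conjE) (rule that)
  have cap: "x t i \<bullet> v \<ge> m" if "t \<ge> 0" "i \<in> I" for t i using cap_all that by blast
  define W where "W = norm e / m"
  have W: "W \<ge> 0" using m by (simp add: W_def)
  have range_at_multiples: "\<exists>lo hi. lo \<le> hi \<and> hi - lo = \<rho> ^ k * (2 * W) \<and>
      quotients_within e v lo hi (real (k * T))" for k :: nat
  proof (induction k)
    case 0
    have "\<bar>x 0 i \<bullet> e\<bar> \<le> W * (x 0 i \<bullet> v)" if "i \<in> I" for i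
    proof -
      have "\<bar>x 0 i \<bullet> e\<bar> \<le> norm e" using Cauchy_Schwarz_ineq2[of "x 0 i" e] unit[of 0] that by simp
      also have "\<dots> = W * m" using m by (simp add: W_def)
      also have "\<dots> \<le> W * (x 0 i \<bullet> v)" using cap[of 0 i] that W by (intro mult_left_mono) auto
      finally show ?thesis .
    qed
    then have "quotients_within e v (- W) W 0"
      unfolding quotients_within_def by (simp add: abs_le_iff minus_le_iff)
    then show ?case using W by (intro exI[of _ "- W"] exI[of _ W]) auto
  next
    case (Suc k)
    then obtain lo hi where IH: "lo \<le> hi" "hi - lo = \<rho> ^ k * (2 * W)"
      "quotients_within e v lo hi (real (k * T))" by (elim exE conjE) (rule that)
    have "0 \<le> real (k * T)" "real (Suc k * T) = real (k * T) + real T" by simp_all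
    with contract IH obtain lo' hi' where "lo' \<le> hi'" "hi' - lo' = \<rho> * (hi - lo)"
      "quotients_within e v lo' hi' (real (Suc k * T))" by metis
    then show ?case by (intro exI[of _ lo'] exI[of _ hi']) (simp add: IH(2))
  qed
  have late: "\<bar>(x t i \<bullet> e) / (x t i \<bullet> v) - (x t r \<bullet> e) / (x t r \<bullet> v)\<bar> \<le> \<rho> ^ k * (2 * W)"
    if t: "t \<ge> real (k * T)" for k :: nat and t
  proof -
    obtain lo hi where lohi: "lo \<le> hi" "hi - lo = \<rho> ^ k * (2 * W)"
      and "quotients_within e v lo hi (real (k * T))"
      using range_at_multiples[of k] by (elim exE conjE) (rule that)
    then have within: "quotients_within e v lo hi t"
      using quotients_within_invariant[OF of_nat_0_le_iff t] by simp
    have t0: "t \<ge> 0" using t of_nat_0_le_iff order_trans by blast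
    have "(x t j \<bullet> e) / (x t j \<bullet> v) \<in> {lo..hi}" if j: "j \<in> I" for j
    proof -
      have "x t j \<bullet> v > 0" using cap[OF t0 j] m by simp
      moreover have "lo * (x t j \<bullet> v) \<le> x t j \<bullet> e" "x t j \<bullet> e \<le> hi * (x t j \<bullet> v)"
        using within j unfolding quotients_within_def by auto
      ultimately show ?thesis by (simp add: pos_le_divide_eq pos_divide_le_eq)
    qed
    from this[OF i] this[OF root] show ?thesis using lohi(2) by (simp add: abs_le_iff)
  qed
  show ?thesis
  proof (rule tendstoI)
    fix \<epsilon> :: real assume "\<epsilon> > 0"
    have "(\<lambda>k. \<rho> ^ k * (2 * W)) \<longlonglongrightarrow> 0 * (2 * W)"
      using \<rho> by (intro tendsto_mult LIMSEQ_power_zero tendsto_const) auto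
    then have "eventually (\<lambda>k. \<rho> ^ k * (2 * W) < \<epsilon>) sequentially"
      using \<open>\<epsilon> > 0\<close> by (intro order_tendstoD(2)[where y = 0]) auto
    then obtain k where k: "\<rho> ^ k * (2 * W) < \<epsilon>" by (auto simp: eventually_sequentially)
    show "\<forall>\<^sub>F t in at_top. dist ((x t i \<bullet> e) / (x t i \<bullet> v) - (x t r \<bullet> e) / (x t r \<bullet> v)) 0 < \<epsilon>"
      using eventually_ge_at_top[of "real (k * T)"]
    proof eventually_elim
      case (elim t)
      then show ?case using late[OF elim] k by (simp add: dist_norm)
    qed
  qed
qed

text \<open>Applying the convergence of quotients to the basis vectors shows that the central projections
  converge to each other. They have norm at least \<open>1\<close>, so the points on the sphere are no farther apart.\<close>

theorem consensus_from_open_hemisphere: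
  assumes v: "norm v = 1" and hemi: "\<And>i. i \<in> I \<Longrightarrow> x 0 i \<bullet> v > 0" and i: "i \<in> I"
  shows "((\<lambda>t. x t i \<bullet> x t r) \<longlongrightarrow> 1) at_top"
proof -
  define m where "m = Min ((\<lambda>i. x 0 i \<bullet> v) ` I)"
  have m: "m > 0" unfolding m_def using finite_agents root hemi by (subst Min_gr_iff) auto
  have cap: "x t j \<bullet> v \<ge> m" if "t \<ge> 0" "j \<in> I" for t j
    using m by (intro cap_invariant[OF _ that]) (auto simp: m_def finite_agents)
  let ?y = "\<lambda>t j. (1 / (x t j \<bullet> v)) *\<^sub>R x t j"
  have "((\<lambda>t. ?y t i - ?y t r) \<longlongrightarrow> 0) at_top"
    unfolding tendsto_componentwise_iff[of "\<lambda>t. ?y t i - ?y t r"]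
    using quotients_converge[OF m v _ i] cap by (auto simp: inner_diff_left)
  then have y: "((\<lambda>t. norm (?y t i - ?y t r)) \<longlongrightarrow> 0) at_top" by (rule tendsto_norm_zero)
  have "((\<lambda>t. x t i - x t r) \<longlongrightarrow> 0) at_top"
  proof (rule Lim_null_comparison[OF _ y], rule eventually_mono[OF eventually_ge_at_top[of 0]])
    fix t :: real assume t: "t \<ge> 0"
    have "1 / (x t j \<bullet> v) \<ge> 1" if "j \<in> I" for j
      using cap[OF t that] m norm_cauchy_schwarz[of "x t j" v] unit[OF t that] v by simp
    then show "norm (x t i - x t r) \<le> norm (?y t i - ?y t r)"
      using unit t i root by (intro norm_diff_le_norm_scaled_diff) auto
  qed
  then have "((\<lambda>t. 1 - (norm (x t i - x t r))\<^sup>2 / 2) \<longlongrightarrow> 1 - 0\<^sup>2 / 2) at_top"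
    by (intro tendsto_intros tendsto_norm_zero) auto
  moreover have "\<forall>\<^sub>F t in at_top. 1 - (norm (x t i - x t r))\<^sup>2 / 2 = x t i \<bullet> x t r"
    using eventually_ge_at_top[of 0]
  proof eventually_elim
    case (elim t)
    have "x t i \<bullet> x t i = 1" "x t r \<bullet> x t r = 1" using unit elim i root by (simp_all add: dot_square_norm)
    then show ?case unfolding power2_norm_eq_inner
      by (simp add: inner_diff_left inner_diff_right inner_commute[of "x t r" "x t i"] field_simps)
  qed
  ultimately show ?thesis using tendsto_cong by fastforce
qed

end

section \<open>Closed polygons of length below \<open>2\<pi>\<close>\<close>

text \<open>The parts of \<open>x\<close> and \<open>z\<close> orthogonal to \<open>y\<close> have the sines of the two angles as norms, so
  Cauchy-Schwarz for these parts is the inequality \<open>cos (\<alpha> + \<beta>) \<le> x \<bullet> z\<close>.\<close>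

lemma arccos_inner_triangle:
  fixes x y z :: "'a::real_inner"
  assumes "norm x = 1" "norm y = 1" "norm z = 1"
  shows "arccos (x \<bullet> z) \<le> arccos (x \<bullet> y) + arccos (y \<bullet> z)"
proof (cases "arccos (x \<bullet> y) + arccos (y \<bullet> z) \<le> pi")
  case False
  have "\<bar>x \<bullet> z\<bar> \<le> 1" using Cauchy_Schwarz_ineq2[of x z] assms by simp
  then have "arccos (x \<bullet> z) \<le> pi" by (intro arccos_ubound) auto
  then show ?thesis using False by linarith
next
  case True
  have unit: "x \<bullet> x = 1" "y \<bullet> y = 1" "z \<bullet> z = 1" using assms by (simp_all add: dot_square_norm)
  have bounds: "\<bar>x \<bullet> y\<bar> \<le> 1" "\<bar>y \<bullet> z\<bar> \<le> 1" "\<bar>x \<bullet> z\<bar> \<le> 1"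
    using Cauchy_Schwarz_ineq2[of x y] Cauchy_Schwarz_ineq2[of y z] Cauchy_Schwarz_ineq2[of x z] assms
    by simp_all
  let ?p = "x - (x \<bullet> y) *\<^sub>R y" and ?q = "z - (y \<bullet> z) *\<^sub>R y"
  have "norm ?p = sin (arccos (x \<bullet> y))" "norm ?q = sin (arccos (y \<bullet> z))"
    using bounds unit
    by (auto simp: sin_arccos_abs norm_eq_sqrt_inner inner_diff_left inner_diff_right inner_commute
        power2_eq_square algebra_simps)
  then have "\<bar>?p \<bullet> ?q\<bar> \<le> sin (arccos (x \<bullet> y)) * sin (arccos (y \<bullet> z))"
    using Cauchy_Schwarz_ineq2[of ?p ?q] by simp
  moreover have "?p \<bullet> ?q = x \<bullet> z - (x \<bullet> y) * (y \<bullet> z)"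
    using unit by (simp add: inner_diff_left inner_diff_right inner_commute algebra_simps)
  ultimately have "cos (arccos (x \<bullet> y) + arccos (y \<bullet> z)) \<le> x \<bullet> z"
    using bounds by (simp add: cos_add cos_arccos_abs abs_le_iff)
  then have "arccos (x \<bullet> z) \<le> arccos (cos (arccos (x \<bullet> y) + arccos (y \<bullet> z)))"
    using bounds by (intro arccos_le_arccos) auto
  also have "\<dots> = arccos (x \<bullet> y) + arccos (y \<bullet> z)"
    using True bounds by (intro arccos_cos add_nonneg_nonneg arccos_lbound) (auto simp: abs_le_iff)
  finally show ?thesis .
qed

lemma arccos_inner_chain:
  fixes p :: "nat \<Rightarrow> 'a::real_inner"
  assumes "a \<le> b" and unit: "\<And>i. i \<le> b \<Longrightarrow> norm (p i) = 1"
    and edge: "\<And>i. i < b \<Longrightarrow> arccos (p i \<bullet> p (Suc i)) \<le> L"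
  shows "arccos (p a \<bullet> p b) \<le> real (b - a) * L"
  using assms
proof (induction b rule: dec_induct)
  case base
  then show ?case by (simp add: dot_square_norm)
next
  case (step k)
  have "arccos (p a \<bullet> p (Suc k)) \<le> arccos (p a \<bullet> p k) + arccos (p k \<bullet> p (Suc k))"
    using step.hyps step.prems by (intro arccos_inner_triangle) auto
  also have "\<dots> \<le> real (k - a) * L + L" using step by (intro add_mono) auto
  also have "\<dots> = real (Suc k - a) * L" using step.hyps by (simp add: Suc_diff_le algebra_simps)
  finally show ?case .
qed

text \<open>With \<open>\<alpha>\<close>, \<open>\<beta>\<close> the two angles the inner product is \<open>cos \<alpha> + cos \<beta>\<close>, and \<open>\<alpha> < \<pi> - \<beta>\<close>.\<close>

lemma inner_sum_pos_of_arccos: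
  fixes x y z :: "'a::real_inner"
  assumes "norm x = 1" "norm y = 1" "norm z = 1" and sum: "arccos (y \<bullet> x) + arccos (x \<bullet> z) < pi"
  shows "x \<bullet> (y + z) > 0"
proof -
  have bounds: "\<bar>y \<bullet> x\<bar> \<le> 1" "\<bar>x \<bullet> z\<bar> \<le> 1"
    using Cauchy_Schwarz_ineq2[of y x] Cauchy_Schwarz_ineq2[of x z] assms by simp_all
  then have "cos (pi - arccos (y \<bullet> x)) < cos (arccos (x \<bullet> z))"
    using sum by (intro cos_monotone_0_pi) (auto simp: abs_le_iff arccos_lbound)
  then show ?thesis
    using bounds by (simp add: cos_arccos_abs inner_add_right inner_commute)
qed

text \<open>The corners \<open>p 0\<close> and \<open>p h\<close> cut the polygon into two chains of length at most \<open>h * L < \<pi>\<close>. Every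
  corner lies on one of them, so its distances to \<open>p 0\<close> and \<open>p h\<close> add up to less than \<open>\<pi>\<close>.\<close>

lemma short_closed_polygon_in_hemisphere:
  fixes p :: "nat \<Rightarrow> 'a::real_inner"
  assumes unit: "\<And>i. i \<le> 2 * h \<Longrightarrow> norm (p i) = 1" and closed: "p (2 * h) = p 0"
    and edge: "\<And>i. i < 2 * h \<Longrightarrow> arccos (p i \<bullet> p (Suc i)) \<le> L" and short: "real h * L < pi"
    and k: "k \<le> 2 * h"
  shows "p k \<bullet> (p 0 + p h) > 0"
proof (cases "k \<le> h")
  case True
  have "arccos (p 0 \<bullet> p k) \<le> real (k - 0) * L" "arccos (p k \<bullet> p h) \<le> real (h - k) * L"
    using True by (intro arccos_inner_chain; auto intro: unit edge)+
  moreover have "real (k - 0) * L + real (h - k) * L = real h * L"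
    using True by (simp add: of_nat_diff algebra_simps)
  ultimately show ?thesis using short True unit by (intro inner_sum_pos_of_arccos) auto
next
  case False
  have "arccos (p h \<bullet> p k) \<le> real (k - h) * L" "arccos (p k \<bullet> p (2 * h)) \<le> real (2 * h - k) * L"
    using False k by (intro arccos_inner_chain; auto intro: unit edge)+
  moreover have "real (k - h) * L + real (2 * h - k) * L = real h * L"
    using False k by (simp add: of_nat_diff algebra_simps)
  ultimately have "p k \<bullet> (p h + p (2 * h)) > 0"
    using short False k unit by (intro inner_sum_pos_of_arccos) auto
  then show ?thesis by (simp add: closed add.commute)
qed

section \<open>Alternating signs on an even ring\<close>

definition alternate :: "(nat \<Rightarrow> real^3) \<Rightarrow> nat \<Rightarrow> real^3" where
  "alternate \<Gamma> i = (- 1) ^ (i - 1) *\<^sub>R \<Gamma> i"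

lemma norm_alternate: "\<Gamma> \<in> sphere_power n \<Longrightarrow> i \<in> {1..n} \<Longrightarrow> norm (alternate \<Gamma> i) = 1"
  unfolding alternate_def sphere_power_def by (auto simp: PiE_iff power_abs)

lemma sign_ring_next:
  assumes "even n" "i \<in> {1..n}"
  shows "(- 1 :: real) ^ (ring_next n i - 1) = - ((- 1) ^ (i - 1))"
  using assms by (cases i) (auto simp: ring_next_def)

lemma sign_ring_prev:
  assumes "even n" "i \<in> {1..n}"
  shows "(- 1 :: real) ^ (ring_prev n i - 1) = - ((- 1) ^ (i - 1))"
proof (cases "i = 1")
  case True
  then show ?thesis using assms by (cases n) (auto simp: ring_prev_def)
next
  case False
  then obtain k where "i = Suc (Suc k)" using assms by (metis One_nat_def atLeastAtMost_iff not_less_eq_eq old.nat.exhaust le_zero_eq)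
  then show ?thesis by (simp add: ring_prev_def)
qed

locale even_ring =
  fixes n :: nat and N :: "nat \<Rightarrow> nat set"
  assumes n2: "n \<ge> 2" and even: "even n" and ring: "undirected_ring n N \<or> directed_ring n N"
begin

lemma ring_neighbours:
  assumes "i \<in> {1..n}"
  shows "N i \<subseteq> {1..n}" "ring_next n i \<in> N i"
proof -
  have "ring_next n i \<in> {1..n}" "ring_prev n i \<in> {1..n}"
    using assms unfolding ring_next_def ring_prev_def by auto
  then show "N i \<subseteq> {1..n}" "ring_next n i \<in> N i"
    using ring assms unfolding undirected_ring_def directed_ring_def by auto
qed

lemma neighbour_sign:
  assumes "i \<in> {1..n}" "j \<in> N i"
  shows "(- 1 :: real) ^ (j - 1) = - ((- 1) ^ (i - 1))"
  using ring assms sign_ring_next[OF even assms(1)] sign_ring_prev[OF even assms(1)]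
  unfolding undirected_ring_def directed_ring_def by auto

lemma first_agent_reachable:
  assumes "i \<in> {1..n}"
  shows "(i, 1) \<in> {(i, j). i \<in> {1..n} \<and> j \<in> N i}\<^sup>*" (is "_ \<in> ?E\<^sup>*")
proof -
  have next_edge: "(i, ring_next n i) \<in> ?E" if "i \<in> {1..n}" for i
    using ring_neighbours(2)[OF that] that by simp
  have "i \<le> n" "1 \<le> i" using assms by auto
  then show ?thesis
  proof (induction i rule: inc_induct)
    case base
    then show ?case using next_edge[of n] by (auto simp: ring_next_def)
  next
    case (step k)
    then show ?case using next_edge[of k] by (auto simp: ring_next_def intro: converse_rtrancl_into_rtrancl)
  qed
qed

text \<open>By the Lagrange identity the right-hand side is minus the tangential part of the sum of the
  neighbours; the sign disappears because the neighbours of an agent have the opposite parity.\<close>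

lemma alternate_consensus:
  assumes \<gamma>: "\<gamma> \<in> closed_loop_trajectories n N"
  shows "sphere_consensus {1..n} N 1 (\<lambda>t. alternate (\<gamma> t))"
proof
  have sphere: "\<gamma> t \<in> sphere_power n" if "t \<ge> 0" for t
    using \<gamma> that unfolding closed_loop_trajectories_def by blast
  show "norm (alternate (\<gamma> t) i) = 1" if "t \<ge> 0" "i \<in> {1..n}" for t i
    using norm_alternate sphere that by blast
  fix t :: real and i assume t: "t \<ge> 0" and i: "i \<in> {1..n}"
  let ?G = "\<gamma> t i" and ?S = "\<Sum>j\<in>N i. \<gamma> t j" and ?\<sigma> = "(- 1 :: real) ^ (i - 1)"
  have "norm ?G = 1" using sphere[OF t] i by (auto simp: sphere_power_def PiE_iff)
  then have GG: "?G \<bullet> ?G = 1" by (simp add: dot_square_norm)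
  have "((\<lambda>s. \<gamma> s i) has_vector_derivative cross3 ?G (cross3 ?G ?S)) (at t within {0..})"
    using \<gamma> t i unfolding closed_loop_trajectories_def by blast
  from bounded_linear.has_vector_derivative[OF bounded_linear_scaleR_right[of ?\<sigma>] this]
  have "((\<lambda>s. alternate (\<gamma> s) i) has_vector_derivative ?\<sigma> *\<^sub>R cross3 ?G (cross3 ?G ?S)) (at t within {0..})"
    by (simp add: alternate_def)
  moreover have "?\<sigma> *\<^sub>R cross3 ?G (cross3 ?G ?S) =
      (\<Sum>j\<in>N i. alternate (\<gamma> t) j - (alternate (\<gamma> t) i \<bullet> alternate (\<gamma> t) j) *\<^sub>R alternate (\<gamma> t) i)"
  proof -
    have "?\<sigma> *\<^sub>R cross3 ?G (cross3 ?G ?S) = ?\<sigma> *\<^sub>R (\<Sum>j\<in>N i. (?G \<bullet> \<gamma> t j) *\<^sub>R ?G - \<gamma> t j)"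
      by (simp add: Lagrange GG inner_sum_right sum_subtractf scaleR_sum_left)
    also have "\<dots> = (\<Sum>j\<in>N i. ?\<sigma> *\<^sub>R ((?G \<bullet> \<gamma> t j) *\<^sub>R ?G - \<gamma> t j))" by (rule scaleR_sum_right)
    also have "\<dots> = (\<Sum>j\<in>N i. alternate (\<gamma> t) j - (alternate (\<gamma> t) i \<bullet> alternate (\<gamma> t) j) *\<^sub>R alternate (\<gamma> t) i)"
    proof (rule sum.cong[OF refl])
      fix j assume "j \<in> N i"
      then have "alternate (\<gamma> t) j = - ?\<sigma> *\<^sub>R \<gamma> t j" using neighbour_sign[OF i] by (simp add: alternate_def)
      moreover have "alternate (\<gamma> t) i = ?\<sigma> *\<^sub>R ?G" by (simp add: alternate_def)
      moreover have "?\<sigma> * ?\<sigma> = 1" by (simp flip: power_add)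
      ultimately show "?\<sigma> *\<^sub>R ((?G \<bullet> \<gamma> t j) *\<^sub>R ?G - \<gamma> t j) =
          alternate (\<gamma> t) j - (alternate (\<gamma> t) i \<bullet> alternate (\<gamma> t) j) *\<^sub>R alternate (\<gamma> t) i"
        by (simp add: scaleR_diff_right mult.assoc[symmetric])
    qed
    finally show ?thesis .
  qed
  ultimately show "((\<lambda>s. alternate (\<gamma> s) i) has_vector_derivative
      (\<Sum>j\<in>N i. alternate (\<gamma> t) j - (alternate (\<gamma> t) i \<bullet> alternate (\<gamma> t) j) *\<^sub>R alternate (\<gamma> t) i))
      (at t within {0..})" by simp
qed (use first_agent_reachable ring_neighbours n2 in auto)

text \<open>The sign change replaces the next point on the ring by its antipode, relative to the current one.\<close>

lemma geodesic_dist_ring_next: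
  assumes "\<Gamma> \<in> sphere_power n" "i \<in> {1..n}"
  shows "geodesic_dist (\<Gamma> i) (\<Gamma> (ring_next n i)) =
           pi - arccos (alternate \<Gamma> i \<bullet> alternate \<Gamma> (ring_next n i))"
proof -
  let ?a = "\<Gamma> i" and ?b = "\<Gamma> (ring_next n i)"
  have "alternate \<Gamma> i \<bullet> alternate \<Gamma> (ring_next n i) = - (?a \<bullet> ?b)"
    using sign_ring_next[OF even assms(2)] by (simp add: alternate_def flip: power_add mult.assoc)
  moreover have "norm ?a = 1" "norm ?b = 1"
    using assms n2 unfolding sphere_power_def ring_next_def by (auto simp: PiE_iff)
  then have "\<bar>?a \<bullet> ?b\<bar> \<le> 1" using Cauchy_Schwarz_ineq2[of ?a ?b] by simp
  ultimately show ?thesis by (simp add: geodesic_dist_def arccos_minus abs_le_iff)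
qed

text \<open>The polygon has the corners \<open>alternate \<Gamma> 1, \<dots>, alternate \<Gamma> n, alternate \<Gamma> 1\<close>, indexed from \<open>0\<close> to \<open>n\<close>.\<close>

lemma attraction_set_in_hemisphere:
  assumes "\<Gamma> \<in> attraction_set n"
  shows "\<exists>v. norm v = 1 \<and> (\<forall>i\<in>{1..n}. alternate \<Gamma> i \<bullet> v > 0)"
proof -
  have sphere: "\<Gamma> \<in> sphere_power n" and W: "min_ring_dist n \<Gamma> > pi - 2 * pi / real n"
    using assms unfolding attraction_set_def by auto
  obtain h where h: "n = 2 * h" using even by (elim evenE)
  have h0: "h > 0" using n2 h by simp
  define L where "L = pi - min_ring_dist n \<Gamma>"
  have "L < 2 * pi / real n" unfolding L_def using W by simp
  then have short: "real h * L < pi" using h h0 by (simp add: field_simps)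
  define p where "p k = alternate \<Gamma> (if k = n then 1 else Suc k)" for k
  have p_unit: "norm (p k) = 1" if "k \<le> 2 * h" for k
    unfolding p_def using norm_alternate[OF sphere] that h n2 by auto
  have p_closed: "p (2 * h) = p 0" unfolding p_def using h n2 by auto
  have edge: "arccos (p k \<bullet> p (Suc k)) \<le> L" if "k < 2 * h" for k
  proof -
    have k: "Suc k \<in> {1..n}" using that h by simp
    have "p (Suc k) = alternate \<Gamma> (ring_next n (Suc k))" "p k = alternate \<Gamma> (Suc k)"
      using that h unfolding p_def ring_next_def by auto
    then have "geodesic_dist (\<Gamma> (Suc k)) (\<Gamma> (ring_next n (Suc k))) = pi - arccos (p k \<bullet> p (Suc k))"
      using geodesic_dist_ring_next[OF sphere k] by simp
    moreover have "min_ring_dist n \<Gamma> \<le> geodesic_dist (\<Gamma> (Suc k)) (\<Gamma> (ring_next n (Suc k)))"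
      unfolding min_ring_dist_def using k by (intro Min_le) auto
    ultimately show ?thesis by (simp add: L_def)
  qed
  have pos: "p k \<bullet> (p 0 + p h) > 0" if "k \<le> 2 * h" for k
    by (rule short_closed_polygon_in_hemisphere[OF p_unit p_closed edge short that])
  from this[of 0] have nz: "p 0 + p h \<noteq> 0" by auto
  show ?thesis
  proof (intro exI[of _ "sgn (p 0 + p h)"] conjI ballI)
    show "norm (sgn (p 0 + p h)) = 1" using nz by (simp add: norm_sgn)
    fix i assume i: "i \<in> {1..n}"
    then have "alternate \<Gamma> i = p (i - 1)" unfolding p_def by auto
    then show "alternate \<Gamma> i \<bullet> sgn (p 0 + p h) > 0"
      using pos[of "i - 1"] nz i h by (auto simp: sgn_div_norm)
  qed
qed

end

section \<open>Distance to the antipodal set\<close>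

lemma alternate_eq_iff: "alternate \<Gamma> i = v \<longleftrightarrow> \<Gamma> i = (- 1) ^ (i - 1) *\<^sub>R v"
  unfolding alternate_def by (auto simp flip: power_add)

lemma antipodal_set_iff:
  "\<Gamma> \<in> antipodal_set n \<longleftrightarrow> \<Gamma> \<in> sphere_power n \<and> (\<exists>v. norm v = 1 \<and> (\<forall>i\<in>{1..n}. alternate \<Gamma> i = v))"
  unfolding antipodal_set_def alternate_eq_iff by auto

lemma inner_alternate_le_1:
  assumes "\<Gamma> \<in> sphere_power n" "i \<in> {1..n}" "norm v = 1"
  shows "\<bar>alternate \<Gamma> i \<bullet> v\<bar> \<le> 1"
  using Cauchy_Schwarz_ineq2[of "alternate \<Gamma> i" v] norm_alternate[OF assms(1,2)] assms(3) by simp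

lemma geodesic_dist_antipodal:
  "geodesic_dist (\<Gamma> i) (\<Gamma>' i) = arccos (alternate \<Gamma> i \<bullet> alternate \<Gamma>' i)"
  unfolding geodesic_dist_def alternate_def by (simp flip: power_add mult.assoc)

lemma max_geodesic_dist_less_iff:
  assumes "n > 0"
  shows "max_geodesic_dist n \<Gamma> \<Gamma>' < d \<longleftrightarrow> (\<forall>i\<in>{1..n}. arccos (alternate \<Gamma> i \<bullet> alternate \<Gamma>' i) < d)"
  unfolding max_geodesic_dist_def geodesic_dist_antipodal using assms by (subst Max_less_iff) auto

lemma max_geodesic_dist_le_iff:
  assumes "n > 0"
  shows "max_geodesic_dist n \<Gamma> \<Gamma>' \<le> d \<longleftrightarrow> (\<forall>i\<in>{1..n}. arccos (alternate \<Gamma> i \<bullet> alternate \<Gamma>' i) \<le> d)"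
  unfolding max_geodesic_dist_def geodesic_dist_antipodal using assms by (subst Max_le_iff) auto

lemma max_geodesic_dist_nonneg:
  assumes "n > 0" "\<Gamma> \<in> sphere_power n" "\<Gamma>' \<in> sphere_power n"
  shows "max_geodesic_dist n \<Gamma> \<Gamma>' \<ge> 0"
proof (rule ccontr)
  assume "\<not> ?thesis"
  then have "arccos (alternate \<Gamma> 1 \<bullet> alternate \<Gamma>' 1) < 0"
    using max_geodesic_dist_less_iff[OF assms(1), of \<Gamma> \<Gamma>' 0] assms(1) by simp
  moreover have "\<bar>alternate \<Gamma> 1 \<bullet> alternate \<Gamma>' 1\<bar> \<le> 1"
    using assms by (intro inner_alternate_le_1 norm_alternate) auto
  ultimately show False
    using arccos_lbound[of "alternate \<Gamma> 1 \<bullet> alternate \<Gamma>' 1"] by (simp add: abs_le_iff)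
qed

text \<open>States are extensional functions, so the representative is \<open>undefined\<close> outside of \<open>{1..n}\<close>.\<close>

definition antipodal_point :: "nat \<Rightarrow> real^3 \<Rightarrow> nat \<Rightarrow> real^3" where
  "antipodal_point n v = (\<lambda>i\<in>{1..n}. (- 1) ^ (i - 1) *\<^sub>R v)"

lemma alternate_antipodal_point: "i \<in> {1..n} \<Longrightarrow> alternate (antipodal_point n v) i = v"
  unfolding alternate_eq_iff antipodal_point_def by simp

lemma antipodal_point_in_antipodal_set: "norm v = 1 \<Longrightarrow> antipodal_point n v \<in> antipodal_set n"
  unfolding antipodal_set_iff using alternate_antipodal_point
  by (auto simp: antipodal_point_def sphere_power_def power_abs)

lemma antipodal_set_nonempty: "antipodal_set n \<noteq> {}"
  using antipodal_point_in_antipodal_set[of "axis 1 1"] by auto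

abbreviation antipodal_dist :: "nat \<Rightarrow> (nat \<Rightarrow> real^3) \<Rightarrow> real" where
  "antipodal_dist n \<equiv> dist_to_set (max_geodesic_dist n) (antipodal_set n)"

lemma antipodal_dist_nonneg:
  assumes "n > 0" "\<Gamma> \<in> sphere_power n"
  shows "antipodal_dist n \<Gamma> \<ge> 0"
  unfolding dist_to_set_def
  using max_geodesic_dist_nonneg[OF assms] antipodal_set_nonempty
  by (intro cINF_greatest) (auto simp: antipodal_set_iff)

text \<open>This and the next lemma translate between the distance to the antipodal set and caps around a
  common point \<open>v\<close>, on which the dynamics is understood.\<close>

lemma antipodal_dist_le:
  assumes n: "n > 0" and \<Gamma>: "\<Gamma> \<in> sphere_power n" and v: "norm v = 1" and \<epsilon>: "0 \<le> \<epsilon>" "\<epsilon> \<le> pi"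
    and cap: "\<And>i. i \<in> {1..n} \<Longrightarrow> alternate \<Gamma> i \<bullet> v \<ge> cos \<epsilon>"
  shows "antipodal_dist n \<Gamma> \<le> \<epsilon>"
  unfolding dist_to_set_def
proof (rule cINF_lower2)
  show "bdd_below (max_geodesic_dist n \<Gamma> ` antipodal_set n)"
    using max_geodesic_dist_nonneg[OF n \<Gamma>] by (intro bdd_belowI2[of _ 0]) (auto simp: antipodal_set_iff)
  show "antipodal_point n v \<in> antipodal_set n" using v by (rule antipodal_point_in_antipodal_set)
  have "arccos (alternate \<Gamma> i \<bullet> v) \<le> \<epsilon>" if "i \<in> {1..n}" for i
  proof -
    have "arccos (alternate \<Gamma> i \<bullet> v) \<le> arccos (cos \<epsilon>)"
      using cap[OF that] inner_alternate_le_1[OF \<Gamma> that v] by (intro arccos_le_arccos) auto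
    then show ?thesis using \<epsilon> by (simp add: arccos_cos)
  qed
  then show "max_geodesic_dist n \<Gamma> (antipodal_point n v) \<le> \<epsilon>"
    unfolding max_geodesic_dist_le_iff[OF n] by (simp add: alternate_antipodal_point)
qed

lemma cap_of_antipodal_dist_less:
  assumes n: "n > 0" and \<Gamma>: "\<Gamma> \<in> sphere_power n" and \<delta>: "\<delta> \<le> pi" and less: "antipodal_dist n \<Gamma> < \<delta>"
  shows "\<exists>v. norm v = 1 \<and> (\<forall>i\<in>{1..n}. alternate \<Gamma> i \<bullet> v \<ge> cos \<delta>)"
proof -
  obtain \<Gamma>' where "\<Gamma>' \<in> antipodal_set n" and close: "max_geodesic_dist n \<Gamma> \<Gamma>' < \<delta>"
    using cInf_lessD[of "max_geodesic_dist n \<Gamma> ` antipodal_set n" \<delta>] antipodal_set_nonempty less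
    unfolding dist_to_set_def by auto
  then obtain v where v: "norm v = 1" "\<forall>i\<in>{1..n}. alternate \<Gamma>' i = v"
    unfolding antipodal_set_iff by blast
  have "alternate \<Gamma> i \<bullet> v \<ge> cos \<delta>" if i: "i \<in> {1..n}" for i
  proof -
    have "arccos (alternate \<Gamma> i \<bullet> v) < \<delta>"
      using close i v(2) unfolding max_geodesic_dist_less_iff[OF n] by auto
    then show ?thesis
      using cos_monotone_0_pi[of "arccos (alternate \<Gamma> i \<bullet> v)" \<delta>] \<delta> inner_alternate_le_1[OF \<Gamma> i v(1)]
      by (auto simp: arccos_lbound abs_le_iff)
  qed
  then show ?thesis using v(1) by blast
qed

section \<open>Stability and attraction\<close>

context even_ring
begin

lemma trajectory_in_sphere_power:
  "\<gamma> \<in> closed_loop_trajectories n N \<Longrightarrow> t \<ge> 0 \<Longrightarrow> \<gamma> t \<in> sphere_power n"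
  unfolding closed_loop_trajectories_def by blast

text \<open>Consensus at \<open>v\<close> is the degenerate cap \<open>x \<bullet> v \<ge> 1\<close>.\<close>

lemma antipodal_set_invariant: "positively_invariant (closed_loop_trajectories n N) (antipodal_set n)"
  unfolding positively_invariant_def
proof (intro ballI impI allI)
  fix \<gamma> and t :: real
  assume \<gamma>: "\<gamma> \<in> closed_loop_trajectories n N" and "\<gamma> 0 \<in> antipodal_set n" and t: "t \<ge> 0"
  then obtain v where v: "norm v = 1" "\<forall>i\<in>{1..n}. alternate (\<gamma> 0) i = v"
    unfolding antipodal_set_iff by blast
  interpret sphere_consensus "{1..n}" N 1 "\<lambda>t. alternate (\<gamma> t)" by (rule alternate_consensus[OF \<gamma>])
  have vv: "v \<bullet> v = 1" using v(1) by (simp add: dot_square_norm)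
  have "alternate (\<gamma> t) i = v" if i: "i \<in> {1..n}" for i
  proof -
    have "alternate (\<gamma> t) i \<bullet> v \<ge> 1" by (rule cap_invariant[OF _ t i]) (use v(2) vv in auto)
    moreover have "alternate (\<gamma> t) i \<bullet> alternate (\<gamma> t) i = 1"
      using unit[OF t i] by (simp add: dot_square_norm)
    ultimately have "(alternate (\<gamma> t) i - v) \<bullet> (alternate (\<gamma> t) i - v) \<le> 0"
      using vv by (simp add: inner_diff_left inner_diff_right inner_commute)
    then show ?thesis by (metis inner_ge_zero inner_eq_zero_iff order_antisym right_minus_eq)
  qed
  then show "\<gamma> t \<in> antipodal_set n"
    unfolding antipodal_set_iff using trajectory_in_sphere_power[OF \<gamma> t] v(1) by blast
qed

lemma antipodal_set_stable: "stable_set (max_geodesic_dist n) (closed_loop_trajectories n N) (antipodal_set n)"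
  unfolding stable_set_def
proof (intro conjI antipodal_set_invariant allI impI)
  fix \<epsilon> :: real assume "\<epsilon> > 0"
  \<comment> \<open>The bound \<open>\<pi>/2\<close> makes \<open>cos \<delta>\<close> nonnegative, as the invariance of caps requires.\<close>
  define \<delta> where "\<delta> = min (\<epsilon> / 2) (pi / 2)"
  have \<delta>: "0 < \<delta>" "\<delta> < \<epsilon>" "\<delta> \<le> pi / 2" using \<open>\<epsilon> > 0\<close> by (auto simp: \<delta>_def)
  have \<delta>pi: "\<delta> \<le> pi" using \<delta>(3) pi_gt_zero by linarith
  have "antipodal_dist n (\<gamma> t) < \<epsilon>"
    if \<gamma>: "\<gamma> \<in> closed_loop_trajectories n N" and near: "antipodal_dist n (\<gamma> 0) < \<delta>" and t: "t \<ge> 0" for \<gamma> t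
  proof -
    interpret sphere_consensus "{1..n}" N 1 "\<lambda>t. alternate (\<gamma> t)" by (rule alternate_consensus[OF \<gamma>])
    obtain v where v: "norm v = 1" "\<forall>i\<in>{1..n}. alternate (\<gamma> 0) i \<bullet> v \<ge> cos \<delta>"
      using cap_of_antipodal_dist_less[OF _ trajectory_in_sphere_power[OF \<gamma>] \<delta>pi near] n2 by auto
    have "cos \<delta> \<ge> 0" using \<delta> by (intro cos_ge_zero) auto
    then have "alternate (\<gamma> t) i \<bullet> v \<ge> cos \<delta>" if "i \<in> {1..n}" for i
      using cap_invariant[OF _ t that] v(2) by blast
    then have "antipodal_dist n (\<gamma> t) \<le> \<delta>"
      using n2 \<delta> \<delta>pi by (intro antipodal_dist_le[OF _ trajectory_in_sphere_power[OF \<gamma> t] v(1)]) auto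
    then show ?thesis using \<delta>(2) by simp
  qed
  then show "\<exists>\<delta>>0. \<forall>\<gamma>\<in>closed_loop_trajectories n N. antipodal_dist n (\<gamma> 0) < \<delta> \<longrightarrow>
      (\<forall>t\<ge>0. antipodal_dist n (\<gamma> t) < \<epsilon>)"
    using \<delta>(1) by blast
qed

text \<open>The radius \<open>\<pi>/n\<close> works: by the triangle inequality, consecutive sign-changed points that are
  closer than \<open>\<pi>/n\<close> to a common point are closer than \<open>2\<pi>/n\<close> to each other.\<close>

lemma attraction_set_contains_nbhd:
  "contains_nbhd_of (sphere_power n) (max_geodesic_dist n) (antipodal_set n) (attraction_set n)"
  unfolding contains_nbhd_of_def
proof
  fix \<Gamma> assume "\<Gamma> \<in> antipodal_set n"
  then obtain v where v: "norm v = 1" "\<forall>i\<in>{1..n}. alternate \<Gamma> i = v"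
    unfolding antipodal_set_iff by blast
  have "{\<Gamma>' \<in> sphere_power n. max_geodesic_dist n \<Gamma> \<Gamma>' < pi / n} \<subseteq> attraction_set n"
  proof
    fix \<Gamma>' assume "\<Gamma>' \<in> {\<Gamma>' \<in> sphere_power n. max_geodesic_dist n \<Gamma> \<Gamma>' < pi / n}"
    then have \<Gamma>': "\<Gamma>' \<in> sphere_power n" and "max_geodesic_dist n \<Gamma> \<Gamma>' < pi / n" by auto
    then have close: "arccos (v \<bullet> alternate \<Gamma>' i) < pi / n" if "i \<in> {1..n}" for i
      using max_geodesic_dist_less_iff[of n \<Gamma> \<Gamma>'] n2 v(2) that by auto
    have "geodesic_dist (\<Gamma>' i) (\<Gamma>' (ring_next n i)) > pi - 2 * pi / n" if i: "i \<in> {1..n}" for i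
    proof -
      have j: "ring_next n i \<in> {1..n}" using i unfolding ring_next_def by auto
      have "arccos (alternate \<Gamma>' i \<bullet> alternate \<Gamma>' (ring_next n i))
          \<le> arccos (alternate \<Gamma>' i \<bullet> v) + arccos (v \<bullet> alternate \<Gamma>' (ring_next n i))"
        using norm_alternate[OF \<Gamma>'] i j v(1) by (intro arccos_inner_triangle) auto
      also have "\<dots> < pi / n + pi / n"
        using close[OF i] close[OF j] by (simp add: inner_commute)
      finally show ?thesis unfolding geodesic_dist_ring_next[OF \<Gamma>' i] by (simp add: field_simps)
    qed
    then have "min_ring_dist n \<Gamma>' > pi - 2 * pi / n"
      unfolding min_ring_dist_def using n2 by (subst Min_gr_iff) auto
    then show "\<Gamma>' \<in> attraction_set n" unfolding attraction_set_def using \<Gamma>' by simp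
  qed
  then show "\<exists>r>0. {\<Gamma>' \<in> sphere_power n. max_geodesic_dist n \<Gamma> \<Gamma>' < r} \<subseteq> attraction_set n"
    using n2 by (intro exI[of _ "pi / n"]) auto
qed

text \<open>The position of agent \<open>1\<close> serves as a moving centre: since the others approach it, the distance to
  the antipodal point that it spans tends to \<open>0\<close>.\<close>

lemma attraction:
  assumes \<gamma>: "\<gamma> \<in> closed_loop_trajectories n N" and init: "\<gamma> 0 \<in> attraction_set n"
  shows "((\<lambda>t. antipodal_dist n (\<gamma> t)) \<longlongrightarrow> 0) at_top"
proof (rule tendstoI)
  interpret sphere_consensus "{1..n}" N 1 "\<lambda>t. alternate (\<gamma> t)" by (rule alternate_consensus[OF \<gamma>])
  fix \<epsilon> :: real assume "\<epsilon> > 0"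
  define \<delta> where "\<delta> = min (\<epsilon> / 2) pi"
  have \<delta>: "0 < \<delta>" "\<delta> < \<epsilon>" "\<delta> \<le> pi" using \<open>\<epsilon> > 0\<close> by (auto simp: \<delta>_def)
  have "cos \<delta> < 1" using cos_monotone_0_pi[of 0 \<delta>] \<delta> by simp
  obtain v where v: "norm v = 1" "\<forall>i\<in>{1..n}. alternate (\<gamma> 0) i \<bullet> v > 0"
    using attraction_set_in_hemisphere[OF init] by blast
  have "\<forall>\<^sub>F t in at_top. \<forall>i\<in>{1..n}. alternate (\<gamma> t) i \<bullet> alternate (\<gamma> t) 1 > cos \<delta>"
  proof (rule eventually_ball_finite)
    show "\<forall>i\<in>{1..n}. \<forall>\<^sub>F t in at_top. alternate (\<gamma> t) i \<bullet> alternate (\<gamma> t) 1 > cos \<delta>"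
    proof
      fix i assume "i \<in> {1..n}"
      then have "((\<lambda>t. alternate (\<gamma> t) i \<bullet> alternate (\<gamma> t) 1) \<longlongrightarrow> 1) at_top"
        using v(2) by (intro consensus_from_open_hemisphere[OF v(1)]) auto
      then show "\<forall>\<^sub>F t in at_top. alternate (\<gamma> t) i \<bullet> alternate (\<gamma> t) 1 > cos \<delta>"
        using \<open>cos \<delta> < 1\<close> by (rule order_tendstoD(1))
    qed
  qed simp
  with eventually_ge_at_top[of 0]
  show "\<forall>\<^sub>F t in at_top. dist (antipodal_dist n (\<gamma> t)) 0 < \<epsilon>"
  proof eventually_elim
    case (elim t)
    have sphere: "\<gamma> t \<in> sphere_power n" by (rule trajectory_in_sphere_power[OF \<gamma> elim(1)])
    have "antipodal_dist n (\<gamma> t) \<le> \<delta>"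
      using elim n2 \<delta> root by (intro antipodal_dist_le[OF _ sphere unit[OF elim(1) root]]) (auto intro: less_imp_le)
    then show ?case using antipodal_dist_nonneg[OF _ sphere] n2 \<delta>(2) by simp
  qed
qed

end

theorem theorem4p3:
  fixes n :: nat and N :: "nat \<Rightarrow> nat set"
  assumes "n \<ge> 2" and "even n"
    and "undirected_ring n N \<or> directed_ring n N"
  shows "asymptotically_stable_with_region (sphere_power n) (max_geodesic_dist n)
           (closed_loop_trajectories n N) (antipodal_set n) (attraction_set n)"
proof -
  interpret even_ring n N using assms by unfold_locales
  show ?thesis
    unfolding asymptotically_stable_with_region_def
    using antipodal_set_stable attraction_set_contains_nbhd attraction by blast
qed

end
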